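(* Let $\Sigma$ be a (possibly infinite) unranked signature, $\mathcal{X}$ an infinite set of variables disjoint from $\Sigma$, and $<$ a well-founded partial order on $\Sigma$. Then the rewrite relation $\Rightarrow$ induced by the system $\mathit{Star}^\omega$ on the trees $\mathbb{T}(\Sigma\cup\Sigma^\omega,\mathcal{X})$ is terminating: there is no infinite sequence $t_0\Rightarrow t_1\Rightarrow t_2\Rightarrow\cdots$.
   Context: Terms: for an unranked signature $\Gamma$ (a set of symbols without fixed arity) and a set $\mathcal{X}$ of variables disjoint from $\Gamma$, the set of terms $\mathcal{T}(\Gamma,\mathcal{X})$ is the smallest set containing $\mathcal{X}$ and containing $f(t_1,\ldots,t_n)$ for all $f\in\Gamma$, $n\ge 0$ and terms $t_1,\ldots,t_n$. The (unordered) trees $\mathbb{T}(\Gamma,\mathcal{X})$ are the equivalence classes of terms modulo the equivalence generated by swapping adjacent arguments of a symbol anywhere inside a term. Rewrite rules are applied to terms under arbitrary contexts and substitutions, and the relation is extended to trees by $[s]\to[t]$ whenever $s\to t$ for terms $s,t$ with classes $[s],[t]$. Energized signature: for every $f\in\Sigma$ and $n\in\mathbb{N}$ let $f^n$ be a fresh symbol, and $\Sigma^\omega=\{f^n\mid f\in\Sigma,\ n\in\mathbb{N}\}$. The system $\mathit{Star}^\omega$ consists of the following rules, for all $n\in\mathbb{N}$ and $f,g\in\Sigma$, where $\vec s,\vec u$ are arbitrary finite (possibly empty) vectors of arguments and $t$ is an argument: (put) $f(\vec s)\Rightarrow f^n(\vec s)$; (select) $f^{n+1}(\vec s,t,\vec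 u)\Rightarrow t$; (copy) $f^{n+1}(\vec s)\Rightarrow g(f^n(\vec s),\ldots,f^n(\vec s))$ with $0$ or more copies of $f^n(\vec s)$, if $f>g$; (down) $f^{n+1}(\vec s,t,\vec u)\Rightarrow f(\vec s,t^n,\ldots,t^n,\vec u)$ with $0$ or more copies of $t^n$, where $t=g(\vec v)$ has an unmarked root symbol $g\in\Sigma$ and $t^n$ denotes $g^n(\vec v)$. *)

theory Defs
  imports Main
begin

section \<open>Terms over unranked signatures\<close>

datatype ('f, 'v) uterm = Var 'v | Fun 'f "('f, 'v) uterm list"

inductive_set terms :: "'f set \<Rightarrow> 'v set \<Rightarrow> ('f, 'v) uterm set"
  for \<Gamma> :: "'f set" and X :: "'v set" where
  Var: "x \<in> X \<Longrightarrow> Var x \<in> terms \<Gamma> X"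
| Fun: "f \<in> \<Gamma> \<Longrightarrow> (\<And>t. t \<in> set ts \<Longrightarrow> t \<in> terms \<Gamma> X) \<Longrightarrow> Fun f ts \<in> terms \<Gamma> X"

fun subst :: "('v \<Rightarrow> ('f, 'w) uterm) \<Rightarrow> ('f, 'v) uterm \<Rightarrow> ('f, 'w) uterm" where
  "subst \<sigma> (Var x) = \<sigma> x"
| "subst \<sigma> (Fun f ts) = Fun f (map (subst \<sigma>) ts)"

datatype ('f, 'v) ctxt =
  Hole
| More 'f "('f, 'v) uterm list" "('f, 'v) ctxt" "('f, 'v) uterm list"

fun fill :: "('f, 'v) ctxt \<Rightarrow> ('f, 'v) uterm \<Rightarrow> ('f, 'v) uterm" where
  "fill Hole s = s"
| "fill (More f ss C us) s = Fun f (ss @ fill C s # us)"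

definition rewrite_step :: "('f, 'v) uterm rel \<Rightarrow> ('f, 'v) uterm rel" where
  "rewrite_step R = {(fill C (subst \<sigma> l), fill C (subst \<sigma> r)) | C \<sigma> l r. (l, r) \<in> R}"


section \<open>Unordered trees\<close>

definition swap_step :: "('f, 'v) uterm \<Rightarrow> ('f, 'v) uterm \<Rightarrow> bool" where
  "swap_step s t \<longleftrightarrow> (\<exists>C f ss u v us.
     s = fill C (Fun f (ss @ u # v # us)) \<and> t = fill C (Fun f (ss @ v # u # us)))"

definition swap_eq :: "('f, 'v) uterm rel" where
  "swap_eq = {(s, t). equivclp swap_step s t}"

definition tree_of :: "('f, 'v) uterm \<Rightarrow> ('f, 'v) uterm set" where
  "tree_of t = swap_eq `` {t}"

text \<open>Swapping changes neither the symbols nor the variables of a term, so the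
  \<^const>\<open>swap_eq\<close>-class of a term over \<open>\<Gamma>\<close> and \<open>X\<close> consists of terms over \<open>\<Gamma>\<close> and \<open>X\<close> only.\<close>

definition trees :: "'f set \<Rightarrow> 'v set \<Rightarrow> ('f, 'v) uterm set set" where
  "trees \<Gamma> X = terms \<Gamma> X // swap_eq"

definition tree_step ::
  "'f set \<Rightarrow> 'v set \<Rightarrow> ('f, 'v) uterm rel \<Rightarrow> ('f, 'v) uterm set rel" where
  "tree_step \<Gamma> X R = {(tree_of s, tree_of t) | s t.
     s \<in> terms \<Gamma> X \<and> t \<in> terms \<Gamma> X \<and> (s, t) \<in> rewrite_step R}"


section \<open>The energized system\<close>

text \<open>\<open>Plain f\<close> is the symbol \<open>f\<close> itself, \<open>Energized f n\<close> the fresh symbol \<open>f\<^sup>n\<close>.\<close>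

datatype 'f sym = Plain 'f | Energized 'f nat

definition energized :: "'f set \<Rightarrow> 'f sym set" where
  "energized \<Sigma> = {Energized f n | f n. f \<in> \<Sigma>}"

definition star_sig :: "'f set \<Rightarrow> 'f sym set" where
  "star_sig \<Sigma> = Plain ` \<Sigma> \<union> energized \<Sigma>"

text \<open>The argument vectors \<open>ss\<close>, \<open>us\<close>, \<open>vs\<close> range over arbitrary lists of terms over
  \<^term>\<open>star_sig \<Sigma>\<close> and \<open>X\<close>; \<open>k\<close> is the number of copies and may be \<open>0\<close>.\<close>

inductive_set star_rules ::
  "'f set \<Rightarrow> ('f \<Rightarrow> 'f \<Rightarrow> bool) \<Rightarrow> 'v set \<Rightarrow> ('f sym, 'v) uterm rel"
  for \<Sigma> :: "'f set" and less :: "'f \<Rightarrow> 'f \<Rightarrow> bool" and X :: "'v set" where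
  put: "f \<in> \<Sigma> \<Longrightarrow> ss \<in> lists (terms (star_sig \<Sigma>) X) \<Longrightarrow>
    (Fun (Plain f) ss, Fun (Energized f n) ss) \<in> star_rules \<Sigma> less X"
| select: "f \<in> \<Sigma> \<Longrightarrow> ss \<in> lists (terms (star_sig \<Sigma>) X) \<Longrightarrow>
    t \<in> terms (star_sig \<Sigma>) X \<Longrightarrow> us \<in> lists (terms (star_sig \<Sigma>) X) \<Longrightarrow>
    (Fun (Energized f (n + 1)) (ss @ t # us), t) \<in> star_rules \<Sigma> less X"
| copy: "f \<in> \<Sigma> \<Longrightarrow> g \<in> \<Sigma> \<Longrightarrow> less g f \<Longrightarrow> ss \<in> lists (terms (star_sig \<Sigma>) X) \<Longrightarrow>
    (Fun (Energized f (n + 1)) ss,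
     Fun (Plain g) (replicate k (Fun (Energized f n) ss))) \<in> star_rules \<Sigma> less X"
| down: "f \<in> \<Sigma> \<Longrightarrow> g \<in> \<Sigma> \<Longrightarrow> ss \<in> lists (terms (star_sig \<Sigma>) X) \<Longrightarrow>
    vs \<in> lists (terms (star_sig \<Sigma>) X) \<Longrightarrow> us \<in> lists (terms (star_sig \<Sigma>) X) \<Longrightarrow>
    (Fun (Energized f (n + 1)) (ss @ Fun (Plain g) vs # us),
     Fun (Plain f) (ss @ replicate k (Fun (Energized g n) vs) @ us)) \<in> star_rules \<Sigma> less X"

end

theory Submission
  imports Defs "HOL-Library.Multiset"
begin

text \<open>Swapping adjacent arguments is invisible when argument lists are read as multisets, so it
  suffices to show that rewriting of trees with multiset branching terminates. This reduces to:
  if all members of the multiset \<open>M\<close> are strongly normalizing, then so are \<open>f(M)\<close> and every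
  \<open>f\<^sup>n(M)\<close>. The latter is proved by induction on \<open>f\<close>, then on \<open>M\<close> with respect to the multiset
  extension of the (well-founded) rewrite relation on strongly normalizing trees, then on the
  energy, where \<open>f\<close> itself counts as \<open>f\<^sup>\<omega>\<close>. A copy step is covered by the first induction, since
  the copies \<open>f\<^sup>n(M)\<close> are strongly normalizing by the third one; a down step is covered by the
  second, because \<open>t\<^sup>n\<close> is a put-reduct of \<open>t\<close>.\<close>

datatype ('f, 'v) mtree = MVar 'v | MFun 'f "('f, 'v) mtree multiset"

primrec mtree_of :: "('f, 'v) uterm \<Rightarrow> ('f, 'v) mtree" where
  "mtree_of (Var x) = MVar x"
| "mtree_of (Fun f ts) = MFun f (mset (map mtree_of ts))"

lemma mtree_of_fill_cong: "mtree_of s = mtree_of t \<Longrightarrow> mtree_of (fill C s) = mtree_of (fill C t)"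
  by (induction C) auto

lemma mtree_of_swap_eq:
  assumes "(s, t) \<in> swap_eq"
  shows "mtree_of s = mtree_of t"
proof -
  have swap: "mtree_of u = mtree_of v" if "swap_step u v" for u v :: "('a, 'b) uterm"
    using that unfolding swap_step_def by (auto intro!: mtree_of_fill_cong)
  have "equivclp swap_step s t"
    using assms by (simp add: swap_eq_def)
  then show ?thesis
    by (induction rule: equivclp_induct) (auto dest: swap)
qed

text \<open>The root steps are schematic in arbitrary trees, so closure under substitution is built
  in; \<open>arg\<close> adds closure under contexts. Membership of symbols in the signature is left
  to \<open>lt\<close>.\<close>

inductive mstep :: "('f \<Rightarrow> 'f \<Rightarrow> bool) \<Rightarrow> ('f sym, 'v) mtree \<Rightarrow> ('f sym, 'v) mtree \<Rightarrow> bool"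
  for lt :: "'f \<Rightarrow> 'f \<Rightarrow> bool" where
  put: "mstep lt (MFun (Plain f) M) (MFun (Energized f n) M)"
| select: "t \<in># M \<Longrightarrow> mstep lt (MFun (Energized f (Suc n)) M) t"
| copy: "lt g f \<Longrightarrow> mstep lt (MFun (Energized f (Suc n)) M)
    (MFun (Plain g) (replicate_mset k (MFun (Energized f n) M)))"
| down: "mstep lt (MFun (Energized f (Suc n)) (add_mset (MFun (Plain g) V) M))
    (MFun (Plain f) (replicate_mset k (MFun (Energized g n) V) + M))"
| arg: "mstep lt s t \<Longrightarrow> mstep lt (MFun a (add_mset s M)) (MFun a (add_mset t M))"

definition SN :: "('f \<Rightarrow> 'f \<Rightarrow> bool) \<Rightarrow> ('f sym, 'v) mtree \<Rightarrow> bool" where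
  "SN lt = Wellfounded.accp (\<lambda>t s. mstep lt s t)"

lemma SN_I: "(\<And>t. mstep lt s t \<Longrightarrow> SN lt t) \<Longrightarrow> SN lt s"
  unfolding SN_def by (rule accp.accI)

lemma SN_step: "SN lt s \<Longrightarrow> mstep lt s t \<Longrightarrow> SN lt t"
  unfolding SN_def by (rule accp_downward)

lemma SN_induct [consumes 1, case_names step]:
  assumes "SN lt s" and "\<And>s. (\<And>t. mstep lt s t \<Longrightarrow> P t) \<Longrightarrow> P s"
  shows "P s"
  using assms(1) unfolding SN_def by (rule accp_induct) (simp add: assms(2))

text \<open>Trees that are not strongly normalizing have no predecessors here, so the relation is
  well-founded on the whole type, as \<open>wf_mult\<close> requires.\<close>

lemma wf_mstep_SN: "wf {(t, s). mstep lt s t \<and> SN lt s}"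
proof (rule wfUNIVI)
  fix P :: "('a sym, 'b) mtree \<Rightarrow> bool" and s
  assume "\<forall>s. (\<forall>t. (t, s) \<in> {(t, s). mstep lt s t \<and> SN lt s} \<longrightarrow> P t) \<longrightarrow> P s"
  then have step: "P s" if "\<And>t. mstep lt s t \<Longrightarrow> SN lt s \<Longrightarrow> P t" for s
    using that by simp
  have SN_P: "P s" if "SN lt s" for s
    using that by (induction rule: SN_induct) (rule step)
  show "P s"
    by (rule step) (blast intro: SN_P SN_step)
qed

lemma SN_MFun:
  fixes M :: "('f sym, 'v) mtree multiset"
  assumes "wfp lt" and "\<forall>t \<in># M. SN lt t"
  shows "SN lt (MFun (Plain f) M) \<and> (\<forall>n. SN lt (MFun (Energized f n) M))"
  using assms
proof (induction f arbitrary: M rule: wfp_induct_rule)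
  case (less f)
  define R :: "('f sym, 'v) mtree rel" where "R = {(t, s). mstep lt s t \<and> SN lt s}"
  have "wf (mult R)"
    unfolding R_def by (intro wf_mult wf_mstep_SN)
  then show ?case
    using less.prems
  proof (induction M rule: wf_induct_rule)
    case (less M)
    \<comment> \<open>This hypothesis holds for every multiset of strongly normalizing trees, not
      only for those below \<open>M\<close>; the copies of \<open>MFun (Energized f n) M\<close> are
      such a multiset.\<close>
    note IH_symbol = \<open>\<And>g M. lt g f \<Longrightarrow> \<forall>t \<in># M. SN lt t \<Longrightarrow> _\<close>
    note IH_args = less.IH
    have SN_M: "\<forall>t \<in># M. SN lt t"
      by (rule less.prems)
    \<comment> \<open>Covers both ways in which arguments shrink: \<open>K\<close> is a single
      reduct for \<open>arg\<close>, and \<open>k\<close> copies of one put-reduct, possibly none,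
      for \<open>down\<close>.\<close>
    have replace: "(K + N, add_mset s N) \<in> mult R \<and> (\<forall>t \<in># K + N. SN lt t)"
      if "M = add_mset s N" and "\<forall>t \<in># K. mstep lt s t" for K N s
    proof -
      have "SN lt s"
        using SN_M that by simp
      then have "(N + K, N + {#s#}) \<in> mult R"
        using that by (intro one_step_implies_mult) (auto simp: R_def)
      moreover have "\<forall>t \<in># K. SN lt t"
        using that \<open>SN lt s\<close> by (blast intro: SN_step)
      ultimately show ?thesis
        using SN_M that by (auto simp: add.commute)
    qed
    have SN_arg: "SN lt (MFun (Plain f) (add_mset t N)) \<and>
        (\<forall>n. SN lt (MFun (Energized f n) (add_mset t N)))"
      if "M = add_mset s N" and "mstep lt s t" for s t N
      using replace[of s N "{#t#}"] IH_args[of "add_mset t N"] that by auto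
    have energized: "SN lt (MFun (Energized f n) M)" for n
    proof (induction n)
      \<comment> \<open>Without energy only \<open>arg\<close> applies.\<close>
      case 0
      show ?case
      proof (rule SN_I)
        fix u
        assume "mstep lt (MFun (Energized f 0) M) u"
        then show "SN lt u"
          by cases (use SN_arg in blast)
      qed
    next
      case (Suc n)
      show ?case
      proof (rule SN_I)
        fix u
        assume "mstep lt (MFun (Energized f (Suc n)) M) u"
        then show "SN lt u"
        proof cases
          case select
          then show ?thesis
            using SN_M by blast
        next
          case (copy g k)
          have "\<forall>t \<in># replicate_mset k (MFun (Energized f n) M). SN lt t"
            using Suc.IH by simp
          then show ?thesis
            using IH_symbol copy by blast
        next
          case (down g V N k)
          have "\<forall>t \<in># replicate_mset k (MFun (Energized g n) V). mstep lt (MFun (Plain g) V) t"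
            by (auto intro: mstep.put)
          then show ?thesis
            using replace IH_args down by blast
        next
          case arg
          then show ?thesis
            using SN_arg by blast
        qed
      qed
    qed
    \<comment> \<open>A put step may choose any energy, so all energies had to be settled
      first.\<close>
    moreover have "SN lt (MFun (Plain f) M)"
    proof (rule SN_I)
      fix u
      assume "mstep lt (MFun (Plain f) M) u"
      then show "SN lt u"
        by cases (use energized SN_arg in blast)+
    qed
    ultimately show ?case
      by blast
  qed
qed

lemma SN_mstep:
  assumes "wfp lt"
  shows "SN lt t"
proof (induction t)
  case (MVar x)
  show ?case
    by (rule SN_I, erule mstep.cases) auto
next
  case (MFun a M)
  then show ?case
    using SN_MFun[OF assms, of M] by (cases a) auto
qed

lemma mstep_fill:
  "mstep lt (mtree_of s) (mtree_of t) \<Longrightarrow> mstep lt (mtree_of (fill C s)) (mtree_of (fill C t))"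
  by (induction C) (auto intro: mstep.arg)

text \<open>The order is cut down to \<open>\<Sigma>\<close>, since only there is it assumed
  well-founded; the premises of the copy rule supply the memberships.\<close>

lemma mstep_star_rules:
  assumes "(l, r) \<in> star_rules \<Sigma> lt X"
  shows "mstep (\<lambda>g f. g \<in> \<Sigma> \<and> f \<in> \<Sigma> \<and> lt g f) (mtree_of (subst \<sigma> l)) (mtree_of (subst \<sigma> r))"
  using assms
proof cases
  case put
  then show ?thesis
    by (auto intro: mstep.put)
next
  case select
  then show ?thesis
    by (auto intro: mstep.select)
next
  case copy
  then show ?thesis
    by (auto intro: mstep.copy)
next
  case (down f g ss vs us n k)
  show ?thesis
    \<comment> \<open>Multisets forget positions, so the arguments on both sides of the consumed one
      merge into \<open>ss @ us\<close>.\<close>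
    using mstep.down[of _ f n g "mset (map (mtree_of \<circ> subst \<sigma>) vs)"
        "mset (map (mtree_of \<circ> subst \<sigma>) (ss @ us))" k]
    by (simp add: down union_ac)
qed

text \<open>All members of a class have the same \<open>mtree_of\<close>, so the representative
  picked by \<open>SOME\<close> does not matter.\<close>

lemma mstep_tree_step:
  assumes "(S, T) \<in> tree_step \<Gamma> X (star_rules \<Sigma> lt X)"
  shows "mstep (\<lambda>g f. g \<in> \<Sigma> \<and> f \<in> \<Sigma> \<and> lt g f)
    (mtree_of (SOME s. s \<in> S)) (mtree_of (SOME t. t \<in> T))"
proof -
  have repr: "mtree_of (SOME s. s \<in> tree_of u) = mtree_of u" for u :: "('a sym, 'b) uterm"
  proof -
    have "u \<in> tree_of u"
      by (simp add: tree_of_def swap_eq_def)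
    then have "(SOME s. s \<in> tree_of u) \<in> tree_of u"
      by (rule someI)
    then show ?thesis
      by (simp add: tree_of_def mtree_of_swap_eq)
  qed
  obtain C \<sigma> l r where "S = tree_of (fill C (subst \<sigma> l))" "T = tree_of (fill C (subst \<sigma> r))"
    "(l, r) \<in> star_rules \<Sigma> lt X"
    using assms unfolding tree_step_def rewrite_step_def by blast
  then show ?thesis
    by (simp add: repr mstep_fill mstep_star_rules)
qed

theorem proposition5p6:
  fixes \<Sigma> :: "'f set" and X :: "'v set" and less :: "'f \<Rightarrow> 'f \<Rightarrow> bool"
  assumes "infinite X"
    and "irreflp_on \<Sigma> less" and "transp_on \<Sigma> less" and "wfp_on \<Sigma> less"
  shows "\<not> (\<exists>t :: nat \<Rightarrow> ('f sym, 'v) uterm set.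
    (\<forall>i. t i \<in> trees (star_sig \<Sigma>) X) \<and>
    (\<forall>i. (t i, t (Suc i)) \<in> tree_step (star_sig \<Sigma>) X (star_rules \<Sigma> less X)))"
proof
  let ?lt = "\<lambda>g f. g \<in> \<Sigma> \<and> f \<in> \<Sigma> \<and> less g f"
  assume "\<exists>t :: nat \<Rightarrow> ('f sym, 'v) uterm set.
    (\<forall>i. t i \<in> trees (star_sig \<Sigma>) X) \<and>
    (\<forall>i. (t i, t (Suc i)) \<in> tree_step (star_sig \<Sigma>) X (star_rules \<Sigma> less X))"
  then obtain t :: "nat \<Rightarrow> ('f sym, 'v) uterm set"
    where "\<And>i. (t i, t (Suc i)) \<in> tree_step (star_sig \<Sigma>) X (star_rules \<Sigma> less X)"
    by blast
  then have mstep: "mstep ?lt (mtree_of (SOME s. s \<in> t i)) (mtree_of (SOME s. s \<in> t (Suc i)))" for i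
    by (rule mstep_tree_step)
  \<comment> \<open>Symbols outside \<open>\<Sigma>\<close> have no \<open>?lt\<close>-predecessors,
    so they are minimal in any set containing them.\<close>
  have "wfp ?lt"
    unfolding wfp_iff_ex_minimal
  proof (intro allI impI)
    fix B :: "'f set"
    assume "B \<noteq> {}"
    show "\<exists>z\<in>B. \<forall>y. ?lt y z \<longrightarrow> y \<notin> B"
    proof (cases "B \<inter> \<Sigma> = {}")
      case True
      then show ?thesis
        using \<open>B \<noteq> {}\<close> by blast
    next
      case False
      then obtain z where "z \<in> B \<inter> \<Sigma>" "\<forall>y \<in> B \<inter> \<Sigma>. \<not> less y z"
        using \<open>wfp_on \<Sigma> less\<close> unfolding wfp_on_iff_ex_minimal by (metis inf_le2)
      then show ?thesis
        by blast
    qed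
  qed
  \<comment> \<open>If a strongly normalizing tree occurred in the sequence, the next entry would be
    a reduct of it, which the induction hypothesis excludes at every index.\<close>
  have "mtree_of (SOME s. s \<in> t i) \<noteq> u" if "SN ?lt u" for u i
    using that
  proof (induction arbitrary: i rule: SN_induct)
    case (step s)
    then show ?case
      using mstep by blast
  qed
  then show False
    using SN_mstep[OF \<open>wfp ?lt\<close>] by blast
qed

end
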